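(* Consider weighted Lagrange interpolation on $[0,\infty)$ with weight $w(t)=e^{-t}$, with $n=2$ and interpolation nodes $x_0=0$, $x_1=1$, $x_2=4$; write $\mathbf{x}=(0,1,4)$. Then the Lebesgue function $L(\mathbf{x},\cdot)$ on the third interval $I_3=[4,\infty)$, where it coincides with the weighted polynomial $P_3(\mathbf{x},\cdot)$, has its maximum exactly at the left endpoint $4$. Furthermore, the derivative of $P_3$ with respect to $t$ at $t=4$ is strictly negative: $$(P_3)'_t(\mathbf{x},4)=-1+\frac34 e^{-4}+\frac43\,\frac{e^{-4}}{e^{-1}}+\frac14+\frac13\approx-0.3365<0.$$
   Context: The fundamental interpolation functions are the weighted polynomials (polynomials of degree at most $2$ times $e^{-t}$) $$h_k(\mathbf{x},t)=\frac{e^{-t}}{e^{-x_k}}\prod_{l=0,\,l\ne k}^{2}\frac{t-x_l}{x_k-x_l},\qquad k=0,1,2,$$ which satisfy $h_k(\mathbf{x},x_j)=1$ if $j=k$ and $0$ otherwise. The Lebesgue function is $L(\mathbf{x},t)=\sum_{k=0}^{2}|h_k(\mathbf{x},t)|$ for $t\in[0,\infty)$. The intervals are $I_1=[x_0,x_1]$, $I_2=[x_1,x_2]$, $I_3=[x_2,\infty)$. On $I_3$ the Lebesgue function agrees with the weighted polynomial $P_3(\mathbf{x},t)=h_0(\mathbf{x},t)-h_1(\mathbf{x},t)+h_2(\mathbf{x},t)$, which is considered for all real $t$; $(P_3)'_t$ denotes its derivative with respect to $t$. *)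

theory Defs
  imports "HOL-Analysis.Analysis"
begin

text \<open>
  A node vector $(x_0, x_1, x_2)$ is a function on the naturals of which only the
  values at 0, 1 and 2 are used.
\<close>

definition weight :: "real \<Rightarrow> real" where
  "weight t = exp (- t)"

definition fund_interp :: "(nat \<Rightarrow> real) \<Rightarrow> nat \<Rightarrow> real \<Rightarrow> real" where
  "fund_interp x k t =
     weight t / weight (x k) * (\<Prod>l\<in>{0..2} - {k}. (t - x l) / (x k - x l))"

definition lebesgue_fun :: "(nat \<Rightarrow> real) \<Rightarrow> real \<Rightarrow> real" where
  "lebesgue_fun x t = (\<Sum>k=0..2. \<bar>fund_interp x k t\<bar>)"

definition I3 :: "(nat \<Rightarrow> real) \<Rightarrow> real set" where
  "I3 x = {x 2..}"

definition P3 :: "(nat \<Rightarrow> real) \<Rightarrow> real \<Rightarrow> real" where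
  "P3 x t = fund_interp x 0 t - fund_interp x 1 t + fund_interp x 2 t"

end

theory Submission
  imports Defs
begin

text \<open>
  Put \<open>t = 4 + s\<close>.  After multiplication by \<open>exp s\<close>, the function \<open>P3 x t\<close> becomes a quadratic
  \<open>1 + b * s + c * s\<^sup>2\<close> in \<open>s\<close>: the constant term is the value \<open>1\<close> at the node \<open>4\<close>, and \<open>b\<close> and
  \<open>c\<close> are linear combinations of \<open>1\<close>, \<open>exp (- 1) ^ 3\<close> and \<open>exp (- 1) ^ 4\<close> such that
  \<open>b < 1\<close> and \<open>c < 1 / 2\<close>.
  So for \<open>s > 0\<close> the quadratic lies strictly below \<open>1 + s + s\<^sup>2 / 2\<close>, hence below \<open>exp s\<close>, and
  \<open>P3 x t < 1 = P3 x 4\<close>.  This is \<open>P3_less_one\<close>.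
  The same expansion shows that the derivative at \<open>4\<close> is \<open>b - 1\<close>, because the weight contributes
  \<open>-1\<close>.

  That the Lebesgue function is \<open>P3\<close> on the third interval is a matter of signs and holds for all
  increasing nodes (\<open>lebesgue_fun_eq_P3\<close>).  The decimal value comes from enclosing \<open>exp (- 1)\<close> by a
  Taylor polynomial with Lagrange remainder.
\<close>

lemma fund_interp_explicit:
  "fund_interp x 0 t = exp (x 0 - t) * ((t - x 1) * (t - x 2) / ((x 0 - x 1) * (x 0 - x 2)))"
  "fund_interp x 1 t = exp (x 1 - t) * ((t - x 0) * (t - x 2) / ((x 1 - x 0) * (x 1 - x 2)))"
  "fund_interp x 2 t = exp (x 2 - t) * ((t - x 0) * (t - x 1) / ((x 2 - x 0) * (x 2 - x 1)))"
proof -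
  have minus: "{0..2::nat} - {0} = {1, 2}" "{0..2::nat} - {1} = {0, 2}" "{0..2::nat} - {2} = {0, 1}"
    by auto
  have w: "weight t / weight (x k) = exp (x k - t)" for k
    by (simp add: weight_def exp_minus exp_diff field_simps)
  show "fund_interp x 0 t = exp (x 0 - t) * ((t - x 1) * (t - x 2) / ((x 0 - x 1) * (x 0 - x 2)))"
    "fund_interp x 1 t = exp (x 1 - t) * ((t - x 0) * (t - x 2) / ((x 1 - x 0) * (x 1 - x 2)))"
    "fund_interp x 2 t = exp (x 2 - t) * ((t - x 0) * (t - x 1) / ((x 2 - x 0) * (x 2 - x 1)))"
    unfolding fund_interp_def w minus by simp_all
qed

text \<open>
  To the right of all nodes every factor \<open>t - x l\<close> is nonnegative, so the sign of the \<open>k\<close>-th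
  summand is the sign of the product of the \<open>x k - x l\<close>, which is negative for \<open>k = 1\<close> only.
\<close>

lemma lebesgue_fun_eq_P3:
  assumes "x 0 < x 1" "x 1 < x 2" "x 2 \<le> t"
  shows "lebesgue_fun x t = P3 x t"
proof -
  have set: "{0..2::nat} = {0, 1, 2}" by auto
  have "fund_interp x 0 t \<ge> 0" "fund_interp x 2 t \<ge> 0" "fund_interp x 1 t \<le> 0"
    unfolding fund_interp_explicit using assms
    by (auto intro!: mult_nonneg_nonneg mult_nonneg_nonpos divide_nonneg_pos divide_nonneg_neg
        mult_neg_neg mult_pos_neg)
  then show ?thesis
    unfolding lebesgue_fun_def P3_def set by simp
qed

lemma exp_minus_one_bounds: "0.367878 \<le> exp (- 1 :: real)" "exp (- 1 :: real) \<le> 0.36788"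
proof -
  obtain u :: real where u: "\<bar>u\<bar> \<le> \<bar>- 1 :: real\<bar>"
    "exp (- 1) = (\<Sum>m<11. (- 1) ^ m / fact m) + exp u / fact 11 * (- 1) ^ 11"
    using Maclaurin_exp_le[of "- 1 :: real" 11] by blast
  have "exp u \<le> exp 1" using u(1) by simp
  then have "exp u \<le> 3" using exp_le by linarith
  have "exp u \<ge> 0" by simp
  have "exp (- 1 :: real) = 16481 / 44800 - exp u / 39916800"
    unfolding u(2) by (simp add: eval_nat_numeral fact_numeral)
  with \<open>exp u \<le> 3\<close> \<open>exp u \<ge> 0\<close>
  have "exp (- 1 :: real) \<ge> 183939 / 500000 \<and> exp (- 1 :: real) \<le> 9197 / 25000" by linarith
  then show "0.367878 \<le> exp (- 1 :: real)" "exp (- 1 :: real) \<le> 0.36788" by simp_all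
qed

lemma exp_minus_four_eq: "exp (- 4 :: real) = exp (- 1) ^ 4"
  and exp_minus_three_eq: "exp (- 3 :: real) = exp (- 1) ^ 3"
  by (simp_all flip: exp_of_nat_mult)

text \<open>
  The window \<open>- 0.3365 \<plusminus> 0.00005\<close> leaves a margin of less than \<open>3 / 10 ^ 6\<close> on the lower side,
  which is what dictates the six decimals in the lower bound for \<open>exp (- 1)\<close>.
\<close>

lemma linear_coefficient_bounds:
  "- 0.33655 \<le> - 1 + (3 / 4 * exp (- 4) + 4 / 3 * exp (- 3) + 7 / 12 :: real)"
  "- 1 + (3 / 4 * exp (- 4) + 4 / 3 * exp (- 3) + 7 / 12 :: real) \<le> - 0.33645"
proof -
  have "(0.367878 :: real) ^ 4 \<le> exp (- 4)" "(0.367878 :: real) ^ 3 \<le> exp (- 3)"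
    "exp (- 4) \<le> (0.36788 :: real) ^ 4" "exp (- 3) \<le> (0.36788 :: real) ^ 3"
    unfolding exp_minus_four_eq exp_minus_three_eq
    using exp_minus_one_bounds by (auto intro!: power_mono)
  then show "- 0.33655 \<le> - 1 + (3 / 4 * exp (- 4) + 4 / 3 * exp (- 3) + 7 / 12 :: real)"
    "- 1 + (3 / 4 * exp (- 4) + 4 / 3 * exp (- 3) + 7 / 12 :: real) \<le> - 0.33645"
    by (simp_all add: power_divide)
qed

context
  fixes x :: "nat \<Rightarrow> real"
  assumes nodes: "x 0 = 0" "x 1 = 1" "x 2 = 4"
begin

lemma P3_expansion:
  "P3 x t = exp (4 - t) * (1 + (3 / 4 * exp (- 4) + 4 / 3 * exp (- 3) + 7 / 12) * (t - 4)
     + (exp (- 4) / 4 + exp (- 3) / 3 + 1 / 12) * (t - 4)\<^sup>2)"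
proof -
  have e: "exp (- t) = exp (4 - t) * exp (- 4)" "exp (1 - t) = exp (4 - t) * exp (- 3)"
    by (simp_all flip: exp_add)
  show ?thesis
    unfolding P3_def fund_interp_explicit nodes
    by (simp add: e field_simps power2_eq_square)
qed

lemma P3_at_4: "P3 x 4 = 1"
  by (simp add: P3_expansion)

lemma P3_less_one:
  assumes "4 < t"
  shows "P3 x t < 1"
proof -
  define s where "s = t - 4"
  define b :: real where "b = 3 / 4 * exp (- 4) + 4 / 3 * exp (- 3) + 7 / 12"
  define c :: real where "c = exp (- 4) / 4 + exp (- 3) / 3 + 1 / 12"
  have "s > 0" using assms by (simp add: s_def)
  have "b < 1" using linear_coefficient_bounds(2) by (simp add: b_def)
  \<comment> \<open>Both exponentials occur in \<open>c\<close> with smaller factors than in \<open>b\<close>, so \<open>c \<le> b - 1 / 2\<close>.\<close>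
  have "c \<le> b - 1 / 2"
  proof -
    have "(0 :: real) \<le> exp (- 4)" "(0 :: real) \<le> exp (- 3)" by simp_all
    then show ?thesis unfolding b_def c_def by linarith
  qed
  with \<open>b < 1\<close> have "c < 1 / 2" by simp
  have "b * s < s" using \<open>b < 1\<close> \<open>s > 0\<close> by simp
  moreover have "c * s\<^sup>2 < s\<^sup>2 / 2"
    using mult_strict_right_mono[OF \<open>c < 1 / 2\<close>, of "s\<^sup>2"] \<open>s > 0\<close> by simp
  moreover have "1 + s + s\<^sup>2 / 2 \<le> exp s"
    using \<open>s > 0\<close> by (intro exp_lower_Taylor_quadratic) simp
  ultimately have "1 + b * s + c * s\<^sup>2 < exp s" by linarith
  then have "exp (- s) * (1 + b * s + c * s\<^sup>2) < exp (- s) * exp s" by simp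
  also have "\<dots> = 1" by (simp flip: exp_add)
  finally show ?thesis
    by (simp add: P3_expansion s_def b_def c_def)
qed

lemma P3_has_derivative_at_4:
  "(P3 x has_real_derivative - 1 + (3 / 4 * exp (- 4) + 4 / 3 * exp (- 3) + 7 / 12)) (at 4)"
  unfolding P3_expansion[abs_def]
  by (auto intro!: derivative_eq_intros)

end

theorem mainTheorem3:
  fixes x :: "nat \<Rightarrow> real"
  assumes "x 0 = 0" and "x 1 = 1" and "x 2 = 4"
  shows "I3 x = {4..}
    \<and> (\<forall>t\<in>I3 x. lebesgue_fun x t = P3 x t)
    \<and> {t. is_arg_max (lebesgue_fun x) (\<lambda>t. t \<in> I3 x) t} = {4}
    \<and> P3 x differentiable (at 4)
    \<and> deriv (P3 x) 4 = - 1 + 3 / 4 * exp (- 4) + 4 / 3 * (exp (- 4) / exp (- 1)) + 1 / 4 + 1 / 3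
    \<and> \<bar>deriv (P3 x) 4 - (- 0.3365)\<bar> \<le> 0.00005
    \<and> deriv (P3 x) 4 < 0"
proof -
  have I3: "I3 x = {4..}" by (simp add: I3_def assms)
  have leb: "lebesgue_fun x t = P3 x t" if "4 \<le> t" for t
    using that assms by (intro lebesgue_fun_eq_P3) simp_all
  have one: "lebesgue_fun x 4 = 1" by (simp add: leb P3_at_4[OF assms])
  have less: "lebesgue_fun x t < 1" if "4 < t" for t
    using that by (simp add: leb P3_less_one[OF assms])
  have argmax: "{t. is_arg_max (lebesgue_fun x) (\<lambda>t. t \<in> I3 x) t} = {4}"
  proof (intro set_eqI)
    fix t
    show "t \<in> {t. is_arg_max (lebesgue_fun x) (\<lambda>t. t \<in> I3 x) t} \<longleftrightarrow> t \<in> {4}"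
      using one less unfolding is_arg_max_def I3 atLeast_iff mem_Collect_eq singleton_iff
      by (metis less_eq_real_def less_asym order.refl)
  qed
  note deriv4 = P3_has_derivative_at_4[OF assms]
  have diff: "P3 x differentiable (at 4)"
    using deriv4 by (auto simp: real_differentiable_def)
  have val: "deriv (P3 x) 4 = - 1 + (3 / 4 * exp (- 4) + 4 / 3 * exp (- 3) + 7 / 12)"
    using deriv4 by (rule DERIV_imp_deriv)
  have "exp (- 4) / exp (- 1) = exp (- 3 :: real)"
    by (simp flip: exp_diff)
  then have formula: "deriv (P3 x) 4
      = - 1 + 3 / 4 * exp (- 4) + 4 / 3 * (exp (- 4) / exp (- 1)) + 1 / 4 + 1 / 3"
    using val by simp
  have bounds: "- 0.33655 \<le> deriv (P3 x) 4" "deriv (P3 x) 4 \<le> - 0.33645"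
    unfolding val by (rule linear_coefficient_bounds)+
  have approx: "\<bar>deriv (P3 x) 4 - (- 0.3365)\<bar> \<le> 0.00005"
    unfolding abs_le_iff using bounds by simp
  have neg: "deriv (P3 x) 4 < 0"
    using bounds by simp
  show ?thesis
    using I3 leb argmax diff formula approx neg by simp
qed

end
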